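(* Any $K$-automorphism $\varphi:\mathrm{M}_{n\times n}(K)\longrightarrow\mathrm{M}_{n\times n}(K)$ of the full $n\times n$ matrix algebra over a field $K$ is conjugation by some invertible matrix $A\in\mathrm{M}_{n\times n}(K)$, i.e., $\varphi(X)=AXA^{-1}$ for all $X\in\mathrm{M}_{n\times n}(K)$.
   Context: $K$ is a field, $n$ is a positive integer, and $\mathrm{M}_{n\times n}(K)$ denotes the $K$-algebra of all $n\times n$ matrices with entries in $K$. A $K$-automorphism of this algebra is a bijective, $K$-linear, multiplicative, unital map from the algebra to itself. *)

theory Defs
  imports "HOL-Analysis.Analysis"
begin

text \<open>
  The ring \<open>M\<^sub>n(K)\<close> is the type \<open>'k^'n^'n\<close> with \<open>'k::field\<close> and \<open>n = CARD('n) \<ge> 1\<close>.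
  Its product is \<open>**\<close> and its unit is \<open>mat 1\<close>; the type class operations \<open>*\<close> and \<open>1\<close>
  on \<open>'k^'n^'n\<close> are entrywise and are not used. The library's \<open>*\<^sub>R\<close> only covers real scalars.
\<close>

definition smult_matrix :: "'k::field \<Rightarrow> 'k^'n^'m \<Rightarrow> 'k^'n^'m" where
  "smult_matrix c X = map_matrix (\<lambda>x. c * x) X"

lemma vector_space_smult_matrix:
  "vector_space (smult_matrix :: 'k::field \<Rightarrow> 'k^'n^'m \<Rightarrow> 'k^'n^'m)"
  by unfold_locales (simp_all add: smult_matrix_def map_matrix_def vec_eq_iff algebra_simps)

definition matrix_algebra_automorphism :: "('k::field^'n^'n \<Rightarrow> 'k^'n^'n) \<Rightarrow> bool" where
  "matrix_algebra_automorphism \<phi> \<longleftrightarrow>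
     bij \<phi> \<and>
     Vector_Spaces.linear smult_matrix smult_matrix \<phi> \<and>
     (\<forall>X Y. \<phi> (X ** Y) = \<phi> X ** \<phi> Y) \<and>
     \<phi> (mat 1) = mat 1"

end

theory Submission
  imports Defs
begin

text \<open>
  An automorphism \<open>\<phi>\<close> makes \<open>K\<^sup>n\<close> an \<open>M\<^sub>n(K)\<close>-module in a second way, with \<open>X\<close> acting
  as \<open>\<phi> X\<close>; an invertible \<open>A\<close> with \<open>A ** X = \<phi> X ** A\<close> is an isomorphism from the
  standard module to this one. To find one, realise the standard module inside the algebra as the
  left ideal of the matrices supported in a fixed column \<open>k\<close>: if \<open>E x\<close> has \<open>x\<close> as its
  column \<open>k\<close>, then \<open>E (X *v x) = X ** E x\<close>. Hence, for every vector \<open>u\<close>, the linear map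
  \<open>x \<mapsto> \<phi> (E x) *v u\<close> intertwines the two actions (\<open>intertwining_matrix_exists\<close>), and it is
  nonzero for a suitable \<open>u\<close> because \<open>\<phi>\<close> is injective. Its kernel is a submodule of the standard
  module, which is simple, so a nonzero intertwiner is invertible
  (\<open>intertwining_matrix_invertible\<close>).
\<close>

definition column_matrix :: "'n \<Rightarrow> 'k::field^'m \<Rightarrow> 'k^'n^'m" where
  "column_matrix k x = (\<chi> i j. if j = k then x $ i else 0)"

lemma column_matrix_add: "column_matrix k (x + y) = column_matrix k x + column_matrix k y"
  by (simp add: column_matrix_def vec_eq_iff)

lemma column_matrix_scale: "column_matrix k (c *s x) = smult_matrix c (column_matrix k x)"
  by (simp add: column_matrix_def smult_matrix_def map_matrix_def vec_eq_iff)

lemma column_matrix_eq_0_iff: "column_matrix k x = 0 \<longleftrightarrow> x = 0"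
  by (auto simp: column_matrix_def vec_eq_iff)

lemma column_matrix_mult_vector:
  fixes v :: "'k::field^'m" and x :: "'k^'n"
  shows "column_matrix k v *v x = x $ k *s v"
  by (simp add: column_matrix_def matrix_vector_mult_def vec_eq_iff if_distrib[of "\<lambda>a. a * _"]
      sum.delta mult.commute[of "x $ k"] cong: if_cong)

lemma matrix_mult_column_matrix:
  fixes X :: "'k::field^'n^'m"
  shows "X ** column_matrix k x = column_matrix k (X *v x)"
  by (auto simp: column_matrix_def matrix_matrix_mult_def matrix_vector_mult_def vec_eq_iff)

lemma smult_matrix_mult_vector:
  fixes X :: "'k::field^'n^'m"
  shows "smult_matrix c X *v u = c *s (X *v u)"
  by (simp add: smult_matrix_def map_matrix_def matrix_vector_mult_def vec_eq_iff
      sum_distrib_left mult.assoc)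

text \<open>
  The standard module is simple: a nonzero vector \<open>x\<close> is mapped to any given vector \<open>y\<close> by
  some matrix, so a vector \<open>x \<noteq> 0\<close> in the kernel of \<open>A\<close> would force \<open>A *v y = 0\<close> for all \<open>y\<close>.
\<close>

lemma intertwining_matrix_invertible:
  fixes A :: "'k::field^'n^'n"
  assumes intertwines: "\<And>X. A ** X = \<psi> X ** A" and "A \<noteq> 0"
  shows "invertible A"
proof -
  have "x = 0" if "A *v x = 0" for x
  proof (rule ccontr)
    assume "x \<noteq> 0"
    then obtain i where i: "x $ i \<noteq> 0"
      by (auto simp: vec_eq_iff)
    have "A *v y = 0" for y
    proof -
      define X :: "'k^'n^'n" where "X = column_matrix i (inverse (x $ i) *s y)"
      have "X *v x = y"
        using i by (simp add: X_def column_matrix_mult_vector vector_smult_assoc)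
      then have "A *v y = (A ** X) *v x"
        by (simp flip: matrix_vector_mul_assoc)
      also have "\<dots> = \<psi> X *v (A *v x)"
        by (simp add: intertwines matrix_vector_mul_assoc)
      finally show ?thesis
        using that by simp
    qed
    then have "A = 0"
      by (simp add: matrix_eq)
    with \<open>A \<noteq> 0\<close> show False ..
  qed
  then show ?thesis
    using matrix_left_invertible_ker[of A] by (auto simp: invertible_left_inverse)
qed

lemma intertwining_matrix_exists:
  fixes \<phi> :: "'k::field^'n^'n \<Rightarrow> 'k^'m^'m"
  assumes lin: "Vector_Spaces.linear smult_matrix smult_matrix \<phi>"
    and "inj \<phi>"
    and mult: "\<And>X Y. \<phi> (X ** Y) = \<phi> X ** \<phi> Y"
  obtains A :: "'k^'n^'m" where "A \<noteq> 0" and "\<And>X. A ** X = \<phi> X ** A"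
proof -
  interpret \<phi>: Vector_Spaces.linear smult_matrix smult_matrix \<phi>
    by (fact lin)
  fix k :: 'n
  have "column_matrix k (axis k 1 :: 'k^'n) \<noteq> 0"
    by (simp add: column_matrix_eq_0_iff axis_eq_0_iff)
  then have "\<phi> (column_matrix k (axis k 1)) \<noteq> 0"
    using \<open>inj \<phi>\<close> \<phi>.zero by (metis injD)
  then obtain u where u: "\<phi> (column_matrix k (axis k 1)) *v u \<noteq> 0"
    by (auto simp: matrix_eq)
  define f where "f x = \<phi> (column_matrix k x) *v u" for x :: "'k^'n"
  have "Vector_Spaces.linear (*s) (*s) f"
    by unfold_locales
      (simp_all add: f_def column_matrix_add column_matrix_scale \<phi>.add \<phi>.scale
        matrix_vector_mult_add_rdistrib smult_matrix_mult_vector)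
  then have matrix_f: "matrix f *v x = f x" for x
    by (rule matrix_works)
  have "matrix f \<noteq> 0"
    using u matrix_f[of "axis k 1"] by (auto simp: f_def)
  moreover have "matrix f ** X = \<phi> X ** matrix f" for X
    by (simp add: matrix_eq matrix_f f_def mult flip: matrix_vector_mul_assoc matrix_mult_column_matrix)
  ultimately show thesis
    by (rule that)
qed

theorem mainTheorem2:
  fixes \<phi> :: "'k::field^'n^'n \<Rightarrow> 'k^'n^'n"
  assumes "matrix_algebra_automorphism \<phi>"
  shows "\<exists>A :: 'k^'n^'n. invertible A \<and> (\<forall>X. \<phi> X = A ** X ** matrix_inv A)"
proof -
  have "Vector_Spaces.linear smult_matrix smult_matrix \<phi>" "inj \<phi>"
    and "\<And>X Y. \<phi> (X ** Y) = \<phi> X ** \<phi> Y"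
    using assms by (auto simp: matrix_algebra_automorphism_def bij_def)
  then obtain A :: "'k^'n^'n" where "A \<noteq> 0" and A: "\<And>X. A ** X = \<phi> X ** A"
    by (rule intertwining_matrix_exists) blast
  have inv: "invertible A"
    by (rule intertwining_matrix_invertible[OF A \<open>A \<noteq> 0\<close>])
  then have "A ** matrix_inv A = mat 1"
    unfolding invertible_def matrix_inv_def by (rule someI2_ex) simp
  then have "\<phi> X = A ** X ** matrix_inv A" for X
    by (simp add: A flip: matrix_mul_assoc)
  with inv show ?thesis
    by blast
qed

end
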